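(* Let $f_1,\dots,f_m:\mathbb{R}^d\to\mathbb{R}$ be twice continuously differentiable and $F=\sum_{i=1}^m f_i$. Assume: (1) the delayed iteration indices $\tau_i^k$ satisfy $0\le k-\tau_i^k\le K$ for all $i,k$ and some $K\ge 0$; (2) $F$ is $\mu$-strongly convex and $L$-smooth with $L\ge\mu>0$; (3) for each $i$ the Hessian $\nabla^2 f_i$ is $L_{H,i}$-Lipschitz continuous, and put $L_H=\sum_{i=1}^m L_{H,i}$. Let $\{\theta^k\}_{k\ge1}$ be generated by the A-CIAG method (see context) with parameters $$\gamma=\frac cL,\qquad \alpha=\frac{1-\sqrt{\mu\gamma}}{1+\sqrt{\mu\gamma}},\qquad c>0.$$ Let $\theta^\star$ be the minimizer of $F$ and $h^{(k)}=F(\theta^k)-F(\theta^\star)$. Suppose $c<\min\{\bar c_1,\bar c_2,\bar c_3,1/2\}$, where $$\bar c_1=\left(\frac{\sqrt\mu}{\sqrt{18}K^2L_H}\,\frac{L^2}{\frac{20L^2}{\mu}(2h^{(1)})^{1/2}+\big(\frac{40L_H}{\mu}\big)^2(2h^{(1)})^{3/2}}\right)^{1/2},$$ $$\bar c_2=\left(\frac{2\mu}{81K^4L_H^2}\,\frac{L^4}{\big(\frac{20L^2}{\mu}\big)^2(2h^{(1)})+\big(\frac{40L_H}{\mu}\big)^4(2h^{(1)})^3}\right)^{1/4},$$ $$\bar c_3=\frac{L}{\sqrt{324}\,K^2L_H\frac{(h^{(1)})^{1/2}}{\sqrt\mu}+1296K^4L_H^2\frac{h^{(1)}}{\mu^2}+\mu}.$$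 Then there is some $\delta<1$ such that $$h^{(k)}\le\delta^{\lceil k/(2K+1)\rceil}\,(2h^{(1)})\qquad\text{for all }k\ge1;$$ moreover, there exists a sequence $\{\bar h^{(k)}\}_{k\ge1}$ with $\bar h^{(k)}\ge h^{(k)}$ for all $k\ge1$ and $\bar h^{(1)}=h^{(1)}$ such that $$\lim_{k\to\infty}\frac{\bar h^{(k+1)}}{\bar h^{(k)}}=1-\sqrt{\mu\gamma}=1-\sqrt{\frac{c}{\kappa(F)}},\qquad\kappa(F)=L/\mu.$$
   Context: $\|\cdot\|$ is the Euclidean norm (for matrices, the induced operator norm). $f$ is $L$-smooth if $f(\theta')\le f(\theta)+\langle\nabla f(\theta),\theta'-\theta\rangle+\frac L2\|\theta'-\theta\|^2$ for all $\theta,\theta'$, and $\mu$-strongly convex if $f(\theta')\ge f(\theta)+\langle\nabla f(\theta),\theta'-\theta\rangle+\frac\mu2\|\theta'-\theta\|^2$ for all $\theta,\theta'$. Delayed indices: at iteration $k\ge1$ an index $i_k\in\{1,\dots,m\}$ is selected, and $\tau_i^k=\max\{\tau\le k: i_\tau=i\}$ is the last iteration, up to and including $k$, at which component $i$ was accessed. The method is assumed to be initialized with all components at $\theta^1$, so that $\tau_i^k=1$ if $i$ has not been selected in iterations $1,\dots,k$; thus $1\le\tau_i^k\le k$ always. A-CIAG method: from an arbitrary $\theta^1\in\mathbb{R}^d$, set $\vartheta^1=\theta^1$ and $\vartheta^k=\theta^k+\alpha(\theta^k-\theta^{k-1})$ for $k\ge2$, and for $k\ge1$ $$\theta^{k+1}=\vartheta^k-\gamma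 g^k,\qquad g^k=\sum_{i=1}^m\Big(\nabla f_i(\vartheta^{\tau_i^k})+\nabla^2 f_i(\vartheta^{\tau_i^k})(\vartheta^k-\vartheta^{\tau_i^k})\Big).$$ Quotients with zero denominator in $\bar c_1,\bar c_2$ (e.g. when $K=0$, $L_H=0$ or $h^{(1)}=0$) are read as $+\infty$. *)

theory Defs
  imports "HOL-Analysis.Analysis"
begin

definition gradient :: "(real ^ 'd \<Rightarrow> real) \<Rightarrow> real ^ 'd \<Rightarrow> real ^ 'd" where
  "gradient f x = (THE D. GDERIV f x :> D)"

definition hessian :: "(real ^ 'd \<Rightarrow> real) \<Rightarrow> real ^ 'd \<Rightarrow> real ^ 'd ^ 'd" where
  "hessian f x = jacobian (gradient f) (at x)"

(* Continuity of the Hessian refers to the product topology on matrices, which agrees with the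
   topology of the operator norm. *)
definition twice_continuously_differentiable :: "(real ^ 'd \<Rightarrow> real) \<Rightarrow> bool" where
  "twice_continuously_differentiable f \<longleftrightarrow>
     f differentiable_on UNIV \<and> gradient f differentiable_on UNIV \<and> continuous_on UNIV (hessian f)"

definition L_smooth :: "real \<Rightarrow> (real ^ 'd \<Rightarrow> real) \<Rightarrow> bool" where
  "L_smooth L f \<longleftrightarrow>
     (\<forall>x y. f y \<le> f x + gradient f x \<bullet> (y - x) + L / 2 * (norm (y - x))\<^sup>2)"

definition strongly_convex :: "real \<Rightarrow> (real ^ 'd \<Rightarrow> real) \<Rightarrow> bool" where
  "strongly_convex \<mu> f \<longleftrightarrow>
     (\<forall>x y. f y \<ge> f x + gradient f x \<bullet> (y - x) + \<mu> / 2 * (norm (y - x))\<^sup>2)"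

(* The operator norm is spelled out with onorm: the library norm on real ^ 'd ^ 'd, hence also
   lipschitz_on, would use the Frobenius norm. *)
definition hessian_lipschitz :: "real \<Rightarrow> (real ^ 'd \<Rightarrow> real) \<Rightarrow> bool" where
  "hessian_lipschitz M f \<longleftrightarrow>
     (\<forall>x y. onorm ((*v) (hessian f x - hessian f y)) \<le> M * norm (x - y))"

(* last_access idx i k is \<tau>_i^k, for the selected indices idx 1, idx 2, ... and k \<ge> 1.
   Inserting 1 accounts for the initialisation of every component at iteration 1. *)
definition last_access :: "(nat \<Rightarrow> nat) \<Rightarrow> nat \<Rightarrow> nat \<Rightarrow> nat" where
  "last_access idx i k = Max (insert 1 {\<tau> \<in> {1..k}. idx \<tau> = i})"

definition extrapolated :: "real \<Rightarrow> (nat \<Rightarrow> real ^ 'd) \<Rightarrow> nat \<Rightarrow> real ^ 'd" where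
  "extrapolated \<alpha> \<theta> k =
     (if k \<le> 1 then \<theta> 1 else \<theta> k + \<alpha> *\<^sub>R (\<theta> k - \<theta> (k - 1)))"

definition curvature_aided_gradient ::
  "nat \<Rightarrow> (nat \<Rightarrow> real ^ 'd \<Rightarrow> real) \<Rightarrow> (nat \<Rightarrow> nat) \<Rightarrow> (nat \<Rightarrow> real ^ 'd) \<Rightarrow> nat \<Rightarrow> real ^ 'd" where
  "curvature_aided_gradient m f idx v k =
     (\<Sum>i = 1..m. let w = v (last_access idx i k) in
        gradient (f i) w + hessian (f i) w *v (v k - w))"

(* The value \<theta> 0 is irrelevant; sequences start at index 1. *)
definition A_CIAG ::
  "nat \<Rightarrow> (nat \<Rightarrow> real ^ 'd \<Rightarrow> real) \<Rightarrow> (nat \<Rightarrow> nat) \<Rightarrow> real \<Rightarrow> real \<Rightarrow> (nat \<Rightarrow> real ^ 'd) \<Rightarrow> bool" where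
  "A_CIAG m f idx \<gamma> \<alpha> \<theta> \<longleftrightarrow>
     (\<forall>k\<ge>1. idx k \<in> {1..m}) \<and>
     (\<forall>k\<ge>1. \<theta> (k + 1) = extrapolated \<alpha> \<theta> k
        - \<gamma> *\<^sub>R curvature_aided_gradient m f idx (extrapolated \<alpha> \<theta>) k)"

(* The bounds on the step-size constant c, as functions of \<mu>, L, L_H, K and h1 = h^(1).
   A quotient with zero denominator is read as \<infinity>. *)
definition cbar1 :: "real \<Rightarrow> real \<Rightarrow> real \<Rightarrow> nat \<Rightarrow> real \<Rightarrow> ereal" where
  "cbar1 \<mu> L LH K h1 =
     (let d1 = sqrt 18 * real K ^ 2 * LH;
          d2 = 20 * L\<^sup>2 / \<mu> * (2 * h1) powr (1 / 2)
               + (40 * LH / \<mu>) ^ 2 * (2 * h1) powr (3 / 2)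
      in if d1 = 0 \<or> d2 = 0 then \<infinity>
         else ereal ((sqrt \<mu> / d1 * (L ^ 2 / d2)) powr (1 / 2)))"

definition cbar2 :: "real \<Rightarrow> real \<Rightarrow> real \<Rightarrow> nat \<Rightarrow> real \<Rightarrow> ereal" where
  "cbar2 \<mu> L LH K h1 =
     (let d1 = 81 * real K ^ 4 * LH ^ 2;
          d2 = (20 * L\<^sup>2 / \<mu>) ^ 2 * (2 * h1) + (40 * LH / \<mu>) ^ 4 * (2 * h1) ^ 3
      in if d1 = 0 \<or> d2 = 0 then \<infinity>
         else ereal ((2 * \<mu> / d1 * (L ^ 4 / d2)) powr (1 / 4)))"

definition cbar3 :: "real \<Rightarrow> real \<Rightarrow> real \<Rightarrow> nat \<Rightarrow> real \<Rightarrow> real" where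
  "cbar3 \<mu> L LH K h1 =
     L / (sqrt 324 * real K ^ 2 * LH * (h1 powr (1 / 2) / sqrt \<mu>)
          + 1296 * real K ^ 4 * LH ^ 2 * (h1 / \<mu> ^ 2) + \<mu>)"

end

(* With s = sqrt (\<mu> * \<gamma>) and z = y + (y - x) / s, the Nesterov energy
   V = F x - F x* + \<mu>/2 |z - x*|^2 satisfies, for an inexact gradient g = G + e,
     V (k+1) + S k \<le> (1 - s) * V k + O(s * r * |e k|)   whenever V \<le> \<mu>/2 * r^2,
   where the slack S k, a combination of |g k|^2 and |y k - x k|^2, controls |y (k+1) - y k|^2.
   The curvature-aided error is quadratic in the displacement over the delay window, so |e k| is
   bounded by the slack accumulated in the window. If r is small enough, summation absorbs the errors
   into the slack. Taking r from the initial energy, which the third step-size bound permits,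
   shows that the energy is summable, hence tends to 0; restarting with an arbitrarily small r, now
   weighting the k-th inequality by (1 - s) ^ -k, gives the exact rate V k = O((1 - s) ^ k). *)
theory Submission
  imports Defs
begin

section \<open>One accelerated step with an inexact gradient\<close>

text \<open>Strong convexity at \<open>y\<close>, used towards \<open>xs\<close> with weight
  \<open>s\<close> and towards \<open>x\<close> with weight \<open>1 - s\<close>, is added to
  smoothness; expanding the square at the new auxiliary point then cancels all inner products with
  \<open>g\<close>. The coefficient of \<gamma> |g|^2 is -3/4 from smoothness, +1/2 from the square
  and +1/8 from the error term, which leaves 1/8 as slack.\<close>

lemma accelerated_step:
  fixes F :: "'a::real_inner \<Rightarrow> real" and x y g G xs :: 'a
  assumes smooth: "F (y - \<gamma> *\<^sub>R g) \<le> F y + G \<bullet> (- (\<gamma> *\<^sub>R g)) + L / 2 * (norm (\<gamma> *\<^sub>R g))\<^sup>2"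
    and convex_min: "F xs \<ge> F y + G \<bullet> (xs - y) + \<mu> / 2 * (norm (xs - y))\<^sup>2"
    and convex_prev: "F x \<ge> F y + G \<bullet> (x - y) + \<mu> / 2 * (norm (x - y))\<^sup>2"
    and s: "0 < s" "s < 1" "s\<^sup>2 = \<mu> * \<gamma>"
    and \<gamma>: "0 < \<gamma>" "L * \<gamma> \<le> 1 / 2"
  shows "F (y - \<gamma> *\<^sub>R g) - F xs
           + \<mu> / 2 * (norm (x + (1 / s) *\<^sub>R (y - \<gamma> *\<^sub>R g - x) - xs))\<^sup>2
           + (\<gamma> / 8 * (norm g)\<^sup>2 + (1 - s\<^sup>2) * \<mu> / (2 * s) * (norm (y - x))\<^sup>2)
         \<le> (1 - s) * (F x - F xs + \<mu> / 2 * (norm (y + (1 / s) *\<^sub>R (y - x) - xs))\<^sup>2)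
           + norm (g - G) * (s * norm (y - xs) + (1 - s) * norm (y - x))
           + 2 * \<gamma> * (norm (g - G))\<^sup>2"
proof -
  define u v e where "u = y - xs" and "v = y - x" and "e = g - G"
  have G: "G = g - e" and xs: "xs - y = - u" and x: "x - y = - v" by (auto simp: u_def v_def e_def)
  have z: "x + (1 / s) *\<^sub>R (y - \<gamma> *\<^sub>R g - x) - xs = u + (1 / s - 1) *\<^sub>R v - (\<gamma> / s) *\<^sub>R g"
    by (simp add: u_def v_def algebra_simps)
  have z': "y + (1 / s) *\<^sub>R v - xs = u + (1 / s) *\<^sub>R v"
    by (simp add: u_def v_def)
  \<comment> \<open>Eliminating \<mu> makes \<open>key\<close> an identity of rational expressions
    in \<open>s\<close> and \<gamma>.\<close>
  have \<mu>: "\<mu> = s\<^sup>2 / \<gamma>" using s \<gamma> by simp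
  have young: "\<gamma> * (e \<bullet> g) \<le> \<gamma> / 8 * (norm g)\<^sup>2 + 2 * \<gamma> * (norm e)\<^sup>2"
  proof -
    have "0 \<le> (norm g - 4 * norm e)\<^sup>2" by simp
    then have "norm e * norm g \<le> (norm g)\<^sup>2 / 8 + 2 * (norm e)\<^sup>2"
      by (simp add: power2_eq_square algebra_simps)
    then have "e \<bullet> g \<le> (norm g)\<^sup>2 / 8 + 2 * (norm e)\<^sup>2"
      using norm_cauchy_schwarz[of e g] by linarith
    then have "\<gamma> * (e \<bullet> g) \<le> \<gamma> * ((norm g)\<^sup>2 / 8 + 2 * (norm e)\<^sup>2)" using \<gamma> by simp
    then show ?thesis by (simp add: algebra_simps)
  qed
  have errs: "- s * (e \<bullet> u) - (1 - s) * (e \<bullet> v) \<le> norm e * (s * norm u + (1 - s) * norm v)"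
  proof -
    have "s * (- e \<bullet> u) \<le> s * (norm e * norm u)"
      using norm_cauchy_schwarz[of "-e" u] s by (intro mult_left_mono) auto
    moreover have "(1 - s) * (- e \<bullet> v) \<le> (1 - s) * (norm e * norm v)"
      using norm_cauchy_schwarz[of "-e" v] s by (intro mult_left_mono) auto
    ultimately show ?thesis by (simp add: algebra_simps)
  qed
  have smooth': "F (y - \<gamma> *\<^sub>R g) \<le> F y - \<gamma> * (norm g)\<^sup>2 + \<gamma> * (e \<bullet> g) + \<gamma> / 4 * (norm g)\<^sup>2"
  proof -
    have "L / 2 * (norm (\<gamma> *\<^sub>R g))\<^sup>2 = (L * \<gamma>) * (\<gamma> / 2 * (norm g)\<^sup>2)"
      by (simp add: power_mult_distrib power2_eq_square)
    also have "\<dots> \<le> 1 / 2 * (\<gamma> / 2 * (norm g)\<^sup>2)"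
      using \<gamma> by (intro mult_right_mono) auto
    finally show ?thesis
      using smooth by (simp add: G inner_diff_left power2_norm_eq_inner algebra_simps)
  qed
  have c1: "s * (F y - F xs) \<le> s * (g \<bullet> u - e \<bullet> u - \<mu> / 2 * (norm u)\<^sup>2)"
    using convex_min s by (intro mult_left_mono) (auto simp: G xs inner_diff_left)
  have c2: "(1 - s) * (F y - F x) \<le> (1 - s) * (g \<bullet> v - e \<bullet> v - \<mu> / 2 * (norm v)\<^sup>2)"
    using convex_prev s by (intro mult_left_mono) (auto simp: G x inner_diff_left)
  \<comment> \<open>The terms in \<open>g \<bullet> u\<close>, \<open>g \<bullet> v\<close> and
    |u|^2 cancel those of \<open>c1\<close> and \<open>c2\<close>; the negative |v|^2 term becomes
    slack.\<close>
  have key: "\<mu> / 2 * (norm (u + (1 / s - 1) *\<^sub>R v - (\<gamma> / s) *\<^sub>R g))\<^sup>2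
     = (1 - s) * (\<mu> / 2 * (norm (u + (1 / s) *\<^sub>R v))\<^sup>2) + s * (\<mu> / 2 * (norm u)\<^sup>2)
       - (1 - s) * \<mu> / (2 * s) * (norm v)\<^sup>2 - s * (g \<bullet> u) - (1 - s) * (g \<bullet> v) + \<gamma> / 2 * (norm g)\<^sup>2"
    using s(1) \<gamma>(1)
    by (simp add: \<mu> power2_norm_eq_inner inner_diff_left inner_diff_right inner_add_left inner_add_right
          inner_commute field_simps)
       (simp add: power2_eq_square algebra_simps)
  \<comment> \<open>The strong convexity term of \<open>c2\<close> raises the factor
    \<open>1 - s\<close> of the |v|^2 slack to \<open>1 - s\<^sup>2\<close>.\<close>
  have coef: "(1 - s\<^sup>2) * \<mu> / (2 * s) * (norm v)\<^sup>2
     = (1 - s) * \<mu> / (2 * s) * (norm v)\<^sup>2 + (1 - s) * (\<mu> / 2 * (norm v)\<^sup>2)"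
    using s(1) by (simp add: field_simps power2_eq_square)
  show ?thesis
    unfolding z key u_def[symmetric] v_def[symmetric] e_def[symmetric] coef z'
    using young errs smooth' c1 c2 by (simp add: algebra_simps) 
qed

section \<open>Recursions with delayed perturbations\<close>

text \<open>After exchanging the sums, each \<open>j\<close> is counted once for every
  \<open>k\<close> with \<open>j < k \<le> j + K\<close>, so at most \<open>K\<close> times.\<close>

lemma sum_delay_window_le:
  fixes T :: "nat \<Rightarrow> real"
  assumes "\<And>j. T j \<ge> 0"
  shows "(\<Sum>k = n..<N. \<Sum>j = k - K..<k. T j) \<le> real K * (\<Sum>j<N. T j)"
proof -
  have "(\<Sum>k = n..<N. \<Sum>j = k - K..<k. T j)
      = (\<Sum>k = n..<N. \<Sum>j \<in> {j. j < N \<and> j < k \<and> k \<le> j + K}. T j)"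
    by (intro sum.cong) auto
  also have "\<dots> = (\<Sum>k = n..<N. \<Sum>j\<in>{j \<in> {..<N}. j < k \<and> k \<le> j + K}. T j)"
    by (auto intro!: sum.cong)
  also have "\<dots> = (\<Sum>j<N. \<Sum>k\<in>{k \<in> {n..<N}. j < k \<and> k \<le> j + K}. T j)"
    by (rule sum.swap_restrict) auto
  also have "\<dots> \<le> (\<Sum>j<N. real K * T j)"
  proof (intro sum_mono)
    fix j
    have "card {k \<in> {n..<N}. j < k \<and> k \<le> j + K} \<le> card {j<..j + K}"
      by (intro card_mono) auto
    then have "card {k \<in> {n..<N}. j < k \<and> k \<le> j + K} \<le> K" by simp
    then show "(\<Sum>k\<in>{k \<in> {n..<N}. j < k \<and> k \<le> j + K}. T j) \<le> real K * T j"
      using assms[of j] by (simp add: mult_right_mono)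
  qed
  finally show ?thesis by (simp add: sum_distrib_left)
qed

text \<open>On telescoping, each \<open>T j\<close> is charged at most \<open>K\<close> times with
  weight \<epsilon>, hence at most once in total. Charges with \<open>n \<le> j\<close> cancel
  against the left side; only those from before \<open>n\<close> remain. \<open>P\<close> carries a
  further gain to be summed.\<close>

lemma delayed_descent:
  fixes U T P :: "nat \<Rightarrow> real"
  assumes T: "\<And>j. T j \<ge> 0" and \<epsilon>: "0 \<le> \<epsilon>" "\<epsilon> * real K \<le> 1" and "n \<le> N"
    and step: "\<And>k. n \<le> k \<Longrightarrow> k < N \<Longrightarrow>
      U (Suc k) + T k + P k \<le> U k + \<epsilon> * (\<Sum>j = k - K..<k. T j)"
  shows "U N + (\<Sum>k = n..<N. P k) \<le> U n + (\<Sum>j<n. T j)"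
proof -
  have "(\<Sum>k = n..<N. U (Suc k) - U k + T k + P k) \<le> (\<Sum>k = n..<N. \<epsilon> * (\<Sum>j = k - K..<k. T j))"
    using step by (intro sum_mono) (auto simp: algebra_simps)
  also have "\<dots> \<le> \<epsilon> * (real K * (\<Sum>j<N. T j))"
    unfolding sum_distrib_left[symmetric]
    using sum_delay_window_le[of T K n N] T \<epsilon> by (intro mult_left_mono) auto
  also have "\<dots> \<le> 1 * (\<Sum>j<N. T j)"
    unfolding mult.assoc[symmetric] using \<epsilon> T by (intro mult_right_mono sum_nonneg) auto
  also have "\<dots> = (\<Sum>j<n. T j) + (\<Sum>k = n..<N. T k)"
    using \<open>n \<le> N\<close> by (simp add: sum.atLeastLessThan_concat lessThan_atLeast0)
  finally show ?thesis
    using sum_Suc_diff'[OF \<open>n \<le> N\<close>, of U] by (simp add: sum.distrib)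
qed

text \<open>Dividing the inequality for \<open>k\<close> by \<open>\<rho> ^ Suc k\<close> turns the
  contraction into plain descent. Slack in the window is up to \<open>K\<close> steps old, which
  costs a factor \<open>\<rho> ^ K\<close> and explains the bound on \<epsilon>.\<close>

lemma geometric_bound_of_delayed_descent:
  fixes V S :: "nat \<Rightarrow> real"
  assumes S: "\<And>j. S j \<ge> 0" and \<rho>: "0 < \<rho>" "\<rho> \<le> 1"
    and \<epsilon>: "0 \<le> \<epsilon>" "\<epsilon> * real K \<le> \<rho> ^ K"
    and step: "\<And>k. n \<le> k \<Longrightarrow> V (Suc k) + S k \<le> \<rho> * V k + \<epsilon> * (\<Sum>j = k - K..<k. S j)"
  shows "\<exists>C. \<forall>k\<ge>n. V k \<le> C * \<rho> ^ k"
proof -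
  define U T where "U = (\<lambda>k. V k / \<rho> ^ k)" and "T = (\<lambda>k. S k / \<rho> ^ Suc k)"
  have T: "T j \<ge> 0" for j using S \<rho> by (simp add: T_def)
  have le: "S j \<le> \<rho> ^ Suc k / \<rho> ^ K * T j" if "j \<in> {k - K..<k}" for j k
  proof -
    have "\<rho> ^ (K + Suc j) \<le> \<rho> ^ Suc k"
      using that \<rho> by (intro power_decreasing) auto
    then have "1 \<le> \<rho> ^ Suc k / (\<rho> ^ K * \<rho> ^ Suc j)"
      using \<rho> by (simp add: power_add)
    from mult_right_mono[OF this S[of j]] show ?thesis by (simp add: T_def del: power_Suc)
  qed
  have "U (Suc k) + T k + 0 \<le> U k + \<epsilon> / \<rho> ^ K * (\<Sum>j = k - K..<k. T j)" if "n \<le> k" for k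
  proof -
    have "(\<Sum>j = k - K..<k. S j) \<le> \<rho> ^ Suc k / \<rho> ^ K * (\<Sum>j = k - K..<k. T j)"
      unfolding sum_distrib_left by (intro sum_mono le)
    then have "V (Suc k) + S k \<le> \<rho> * V k + \<epsilon> * (\<rho> ^ Suc k / \<rho> ^ K * (\<Sum>j = k - K..<k. T j))"
      using step[OF that] mult_left_mono[OF _ \<epsilon>(1)] by fastforce
    then have "(V (Suc k) + S k) / \<rho> ^ Suc k
        \<le> (\<rho> * V k + \<epsilon> * (\<rho> ^ Suc k / \<rho> ^ K * (\<Sum>j = k - K..<k. T j))) / \<rho> ^ Suc k"
      using \<rho> by (intro divide_right_mono) auto
    also have "\<dots> = U k + \<epsilon> / \<rho> ^ K * (\<Sum>j = k - K..<k. T j)"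
      using \<rho> by (simp add: U_def add_divide_distrib)
    finally show ?thesis by (simp add: U_def T_def add_divide_distrib)
  qed
  then have "U N + (\<Sum>k = n..<N. 0) \<le> U n + (\<Sum>j<n. T j)" if "n \<le> N" for N
    using T \<rho> \<epsilon> that by (intro delayed_descent[where \<epsilon> = "\<epsilon> / \<rho> ^ K" and K = K]) (auto simp: field_simps)
  then have "V N \<le> (U n + (\<Sum>j<n. T j)) * \<rho> ^ N" if "n \<le> N" for N
    using that \<rho> by (simp add: U_def divide_simps)
  then show ?thesis by blast
qed

lemma power2_sum_le_card_mult_sum:
  fixes a :: "'a \<Rightarrow> real"
  shows "(\<Sum>i\<in>A. a i)\<^sup>2 \<le> real (card A) * (\<Sum>i\<in>A. (a i)\<^sup>2)"
  using Cauchy_Schwarz_ineq_sum[of "\<lambda>_. 1" a A] by simp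

section \<open>Gradients and Hessians\<close>

text \<open>The derivative \<open>D\<close> is represented by the vector \<open>adjoint D 1\<close>;
  uniqueness of derivatives then justifies the definite description in
  \<open>gradient\<close>.\<close>

lemma gradient_works:
  assumes "f differentiable (at x)"
  shows "GDERIV f x :> gradient f x"
proof -
  obtain D where D: "(f has_derivative D) (at x)" using assms by (auto simp: differentiable_def)
  then interpret D: linear D by (rule has_derivative_linear)
  have "D = (\<lambda>h. h \<bullet> adjoint D 1)"
    using adjoint_works[OF D.linear_axioms, of _ 1] by (auto simp: fun_eq_iff)
  with D have ex: "GDERIV f x :> adjoint D 1" by (simp add: gderiv_def)
  have "E = adjoint D 1" if "GDERIV f x :> E" for E
    using has_derivative_unique[OF that[unfolded gderiv_def] ex[unfolded gderiv_def]]
    by (metis vector_eq_ldot)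
  with ex show ?thesis unfolding gradient_def by (rule theI)
qed

lemma gradient_eqI:
  assumes "GDERIV f x :> D" shows "gradient f x = D"
proof -
  have "GDERIV f x :> gradient f x"
    using assms by (intro gradient_works) (auto simp: gderiv_def differentiable_def)
  from has_derivative_unique[OF this[unfolded gderiv_def] assms[unfolded gderiv_def]]
  show ?thesis by (metis vector_eq_ldot)
qed

lemma gradient_sum:
  assumes "\<And>i. i \<in> I \<Longrightarrow> f i differentiable (at x)"
  shows "gradient (\<lambda>x. \<Sum>i\<in>I. f i x) x = (\<Sum>i\<in>I. gradient (f i) x)"
proof (rule gradient_eqI)
  have "(f i has_derivative (\<lambda>h. h \<bullet> gradient (f i) x)) (at x)" if "i \<in> I" for i
    using gradient_works[OF assms[OF that]] by (simp add: gderiv_def)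
  from has_derivative_sum[of I, OF this]
  show "GDERIV (\<lambda>x. \<Sum>i\<in>I. f i x) x :> (\<Sum>i\<in>I. gradient (f i) x)"
    by (simp add: gderiv_def inner_sum_right)
qed

text \<open>Along the segment from \<open>x\<close> to \<open>y\<close> the remainder has derivative
  of norm at most M t |d|^2. Comparison with the real function M/2 t^2 |d|^2 through the mean value
  inequality replaces integration.\<close>

lemma gradient_taylor_remainder:
  fixes f :: "real ^ 'd \<Rightarrow> real"
  assumes C2: "twice_continuously_differentiable f" and lip: "hessian_lipschitz M f"
  shows "norm (gradient f x + hessian f x *v (y - x) - gradient f y) \<le> M / 2 * (norm (y - x))\<^sup>2"
proof -
  define d where "d = y - x"
  define \<phi> where "\<phi> = (\<lambda>t. gradient f (x + t *\<^sub>R d) - t *\<^sub>R (hessian f x *v d))"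
  have hess: "(gradient f has_derivative (*v) (hessian f w)) (at w)" for w
    using C2 jacobian_works[of "gradient f" "at w"]
    by (simp add: twice_continuously_differentiable_def differentiable_on_def hessian_def)
  have \<phi>: "(\<phi> has_vector_derivative (hessian f (x + t *\<^sub>R d) - hessian f x) *v d) (at t)" for t
    unfolding \<phi>_def has_vector_derivative_def
    by (rule derivative_eq_intros has_derivative_compose[OF _ hess] refl)+
       (simp add: matrix_vector_mult_diff_rdistrib matrix_vector_mult_scaleR algebra_simps)
  have \<psi>: "((\<lambda>t. M / 2 * t\<^sup>2 * (norm d)\<^sup>2) has_vector_derivative M * t * (norm d)\<^sup>2) (at t)" for t
    by (rule has_real_derivative_iff_has_vector_derivative[THEN iffD1])
       (auto intro!: derivative_eq_intros)
  have bound: "norm ((hessian f (x + t *\<^sub>R d) - hessian f x) *v d) \<le> M * t * (norm d)\<^sup>2"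
    if "0 < t" for t
  proof -
    have "norm ((hessian f (x + t *\<^sub>R d) - hessian f x) *v d)
        \<le> onorm ((*v) (hessian f (x + t *\<^sub>R d) - hessian f x)) * norm d"
      by (intro onorm) simp
    also have "\<dots> \<le> M * norm (x + t *\<^sub>R d - x) * norm d"
      using lip unfolding hessian_lipschitz_def by (intro mult_right_mono, blast, simp)
    finally show ?thesis using that by (simp add: power2_eq_square mult_ac)
  qed
  have "norm (\<phi> 1 - \<phi> 0) \<le> M / 2 * 1\<^sup>2 * (norm d)\<^sup>2 - M / 2 * 0\<^sup>2 * (norm d)\<^sup>2"
    by (rule differentiable_bound_general[OF _ _ _ \<phi> \<psi> bound])
       (auto intro!: continuous_at_imp_continuous_on has_vector_derivative_continuous[OF \<phi>]
          has_vector_derivative_continuous[OF \<psi>, unfolded times_divide_eq_left times_divide_eq_right])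
  then show ?thesis
    by (simp add: \<phi>_def d_def norm_minus_commute algebra_simps)
qed

text \<open>The Lipschitz bound is tested at two distinct points, the all-ones vector and 0.\<close>

lemma hessian_lipschitz_nonneg:
  fixes f :: "real ^ 'd \<Rightarrow> real"
  assumes "hessian_lipschitz M f" shows "M \<ge> 0"
proof -
  have "onorm ((*v) (hessian f (1 :: real ^ 'd) - hessian f 0)) \<le> M * norm (1 - 0 :: real ^ 'd)"
    using assms unfolding hessian_lipschitz_def by blast
  moreover have "onorm ((*v) (hessian f (1 :: real ^ 'd) - hessian f 0)) \<ge> 0"
    by (intro onorm_pos_le) simp
  ultimately have "0 \<le> M * norm (1 :: real ^ 'd)" by simp
  then show ?thesis by (simp add: zero_le_mult_iff)
qed

section \<open>Accelerated descent with delayed quadratic errors\<close>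

text \<open>Sequences start at index 0 here, whereas the iteration in the theorem starts at 1.\<close>

locale perturbed_acceleration =
  fixes F :: "'a::real_inner \<Rightarrow> real" and G :: "'a \<Rightarrow> 'a"
    and x y g :: "nat \<Rightarrow> 'a" and xs :: 'a
    and \<mu> L \<gamma> s M :: real and K :: nat
  assumes smooth: "F v \<le> F u + G u \<bullet> (v - u) + L / 2 * (norm (v - u))\<^sup>2"
    and convex: "F v \<ge> F u + G u \<bullet> (v - u) + \<mu> / 2 * (norm (v - u))\<^sup>2"
    and minimal: "F xs \<le> F u"
    and params: "0 < \<mu>" "0 < L" "0 < \<gamma>" "L * \<gamma> \<le> 1 / 2" "0 < s" "s\<^sup>2 = \<mu> * \<gamma>" "s\<^sup>2 \<le> 1 / 2" "0 \<le> M"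
    and x_Suc: "x (Suc k) = y k - \<gamma> *\<^sub>R g k"
    and y_0: "y 0 = x 0"
    and y_Suc: "y (Suc k) = x (Suc k) + ((1 - s) / (1 + s)) *\<^sub>R (x (Suc k) - x k)"
    and delayed_error: "(\<And>j. j \<in> {k - K..k} \<Longrightarrow> norm (y k - y j) \<le> b) \<Longrightarrow>
      norm (g k - G (y k)) \<le> M / 2 * b\<^sup>2"
begin

text \<open>Auxiliary point of Nesterov's scheme: \<open>y k\<close> is the convex combination of
  \<open>x k\<close> and \<open>z k\<close> with weights \<open>1 / (1 + s)\<close> and
  \<open>s / (1 + s)\<close>.\<close>

definition z :: "nat \<Rightarrow> 'a" where
  "z k = y k + (1 / s) *\<^sub>R (y k - x k)"

definition V :: "nat \<Rightarrow> real" where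
  "V k = F (x k) - F xs + \<mu> / 2 * (norm (z k - xs))\<^sup>2"

text \<open>The two coefficients are those of the slack in \<open>accelerated_step\<close>.\<close>

definition S :: "nat \<Rightarrow> real" where
  "S k = \<gamma> / 8 * (norm (g k))\<^sup>2 + (1 - s\<^sup>2) * \<mu> / (2 * s) * (norm (y k - x k))\<^sup>2"

text \<open>A rational bound above sqrt (1/2); the value 3/4 is what gives
  \<open>24 / 18 * s \<le> 1\<close> in \<open>V_sum_le\<close>.\<close>

lemma s_le: "s \<le> 3 / 4"
  using params by (intro power2_le_imp_le[of s "3 / 4"]) (auto simp: power2_eq_square)

lemma s_less_1: "s < 1"
  using s_le by simp

lemma S_nonneg: "S k \<ge> 0"
  using params unfolding S_def by (intro add_nonneg_nonneg mult_nonneg_nonneg divide_nonneg_nonneg) auto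

lemma gap_nonneg: "0 \<le> F (x k) - F xs"
  using minimal by simp

lemma gap_le_V: "F (x k) - F xs \<le> V k"
  using params by (simp add: V_def)

lemma V_nonneg: "V k \<ge> 0"
  using gap_nonneg gap_le_V order_trans by blast

text \<open>Otherwise a gradient step of size \<open>1 / L\<close> from \<open>xs\<close> would
  lower \<open>F\<close> by |G xs|^2 / (2 L). The argument rests on the smoothness inequality
  because \<open>G\<close> is not tied to a derivative in this locale.\<close>

lemma gradient_minimizer: "G xs = 0"
proof -
  have "F xs \<le> F (xs - (1 / L) *\<^sub>R G xs)" by (rule minimal)
  also have "\<dots> \<le> F xs - 1 / L * (norm (G xs))\<^sup>2 + L / 2 * ((1 / L)\<^sup>2 * (norm (G xs))\<^sup>2)"
    using smooth[of "xs - (1 / L) *\<^sub>R G xs" xs] params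
    by (simp add: power2_norm_eq_inner[symmetric] power_mult_distrib power_divide)
  also have "\<dots> = F xs - 1 / (2 * L) * (norm (G xs))\<^sup>2"
    using params by (simp add: field_simps power2_eq_square)
  finally have "1 / (2 * L) * (norm (G xs))\<^sup>2 \<le> 0" by simp
  then show ?thesis using params by (simp add: divide_le_0_iff)
qed

lemma norm_le_gap: "\<mu> / 2 * (norm (x k - xs))\<^sup>2 \<le> F (x k) - F xs"
  using convex[of xs "x k"] by (simp add: gradient_minimizer)

text \<open>Since \<open>y 0 = x 0\<close>, also \<open>z 0 = x 0\<close>, and strong convexity
  bounds the distance term by the gap.\<close>

lemma V_0_le: "V 0 \<le> 2 * (F (x 0) - F xs)"
  using norm_le_gap[of 0] by (simp add: V_def z_def y_0)

text \<open>The momentum coefficient satisfies \<open>(1 + 1 / s) * \<alpha> = 1 / s - 1\<close>,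
  which puts the new auxiliary point into the form used by \<open>accelerated_step\<close>.\<close>

lemma z_Suc: "z (Suc k) = x k + (1 / s) *\<^sub>R (x (Suc k) - x k)"
proof -
  define \<alpha> d where "\<alpha> = (1 - s) / (1 + s)" and "d = x (Suc k) - x k"
  have "z (Suc k) = x (Suc k) + ((1 + 1 / s) * \<alpha>) *\<^sub>R d"
    by (simp add: z_def y_Suc \<alpha>_def[symmetric] d_def[symmetric] distrib_right scaleR_add_left)
  also have "(1 + 1 / s) * \<alpha> = 1 / s - 1"
  proof -
    have "(1 + 1 / s) * \<alpha> = (1 + s) / s * ((1 - s) / (1 + s))"
      using params by (simp add: \<alpha>_def add_divide_distrib)
    also have "\<dots> = (1 - s) / s" using params by simp
    finally show ?thesis using params by (simp add: diff_divide_distrib)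
  qed
  also note d_def
  finally show ?thesis by (simp add: algebra_simps)
qed

section \<open>Distances and step lengths in terms of energy and slack\<close>

lemma y_minus_x: "y k - x k = (s / (1 + s)) *\<^sub>R (z k - x k)"
proof -
  have "z k - x k = (1 + 1 / s) *\<^sub>R (y k - x k)" by (simp add: z_def algebra_simps)
  moreover have "s / (1 + s) * (1 + 1 / s) = 1"
  proof -
    have "1 + 1 / s = (1 + s) / s" using params by (simp add: add_divide_distrib)
    then show ?thesis using params by simp
  qed
  ultimately show ?thesis by (metis scaleR_one scaleR_scaleR)
qed

text \<open>The energy dominates the squared distances of \<open>x k\<close> and \<open>z k\<close>
  from \<open>xs\<close>, and \<open>y k\<close> is a convex combination of the two. The constant
  3/2 is a rational bound for sqrt 2. The factor \<open>s\<close> in the second bound makes the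
  error in \<open>V_step\<close> proportional to \<open>s\<close>.\<close>

lemma norm_bounds:
  assumes "V k \<le> \<mu> / 2 * r\<^sup>2" "0 \<le> r"
  shows "norm (y k - xs) \<le> r" "norm (y k - x k) \<le> 3 / 2 * s * r"
proof -
  have sum: "(norm (x k - xs))\<^sup>2 + (norm (z k - xs))\<^sup>2 \<le> r\<^sup>2"
  proof -
    have "\<mu> / 2 * ((norm (x k - xs))\<^sup>2 + (norm (z k - xs))\<^sup>2) \<le> \<mu> / 2 * r\<^sup>2"
      using norm_le_gap[of k] assms by (simp add: V_def algebra_simps)
    then show ?thesis using params by simp
  qed
  have "(norm (x k - xs))\<^sup>2 \<le> r\<^sup>2" "(norm (z k - xs))\<^sup>2 \<le> r\<^sup>2"
    using sum zero_le_power2[of "norm (x k - xs)"] zero_le_power2[of "norm (z k - xs)"] by linarith+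
  then have nx: "norm (x k - xs) \<le> r" and nz: "norm (z k - xs) \<le> r"
    using assms(2) by (auto dest: power2_le_imp_le)
  have "y k - xs = (1 / (1 + s)) *\<^sub>R (x k - xs) + (s / (1 + s)) *\<^sub>R (z k - xs)"
  proof -
    have "y k - xs = (x k - xs) + (s / (1 + s)) *\<^sub>R ((z k - xs) - (x k - xs))"
      using y_minus_x[of k] by (simp add: algebra_simps)
    also have "\<dots> = (1 - s / (1 + s)) *\<^sub>R (x k - xs) + (s / (1 + s)) *\<^sub>R (z k - xs)"
      by (simp only: scaleR_diff_right scaleR_diff_left) simp
    also have "1 - s / (1 + s) = 1 / (1 + s)" using params by (simp add: field_simps)
    finally show ?thesis .
  qed
  then have "norm (y k - xs) \<le> 1 / (1 + s) * norm (x k - xs) + s / (1 + s) * norm (z k - xs)"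
    using norm_triangle_ineq[of "(1 / (1 + s)) *\<^sub>R (x k - xs)" "(s / (1 + s)) *\<^sub>R (z k - xs)"] params by simp
  also have "\<dots> \<le> 1 / (1 + s) * r + s / (1 + s) * r"
    using nx nz params by (intro add_mono mult_left_mono) auto
  also have "\<dots> = (1 + s) / (1 + s) * r" by (simp only: add_divide_distrib distrib_right)
  also have "\<dots> = r" using params by simp
  finally show "norm (y k - xs) \<le> r" .
  have "(norm (z k - x k))\<^sup>2 \<le> 2 * r\<^sup>2"
  proof -
    have "norm (z k - x k) \<le> norm (x k - xs) + norm (z k - xs)"
      using norm_triangle_ineq4[of "z k - xs" "x k - xs"] by simp
    then have "(norm (z k - x k))\<^sup>2 \<le> (norm (x k - xs) + norm (z k - xs))\<^sup>2"
      by (intro power_mono) auto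
    also have "\<dots> \<le> 2 * ((norm (x k - xs))\<^sup>2 + (norm (z k - xs))\<^sup>2)"
      using sum_squares_bound[of "norm (x k - xs)" "norm (z k - xs)"]
      by (simp add: power2_sum)
    finally show ?thesis using sum by simp
  qed
  also have "\<dots> \<le> (3 / 2 * r)\<^sup>2"
    using zero_le_power2[of r] unfolding power_mult_distrib by (simp add: power2_eq_square)
  finally have "norm (z k - x k) \<le> 3 / 2 * r" by (rule power2_le_imp_le) (use assms in simp)
  then have "s / (1 + s) * norm (z k - x k) \<le> s * (3 / 2 * r)"
    using params by (intro mult_mono) (auto simp: field_simps)
  then show "norm (y k - x k) \<le> 3 / 2 * s * r"
    using params by (simp add: y_minus_x)
qed

text \<open>The step is a linear combination of \<open>y k - x k\<close> and \<open>g k\<close>, the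
  two vectors whose squared norms make up \<open>S k\<close>.\<close>

lemma step_length: "(norm (y (Suc k) - y k))\<^sup>2 \<le> 16 * (\<gamma> / s) * S k"
proof -
  let ?\<alpha> = "(1 - s) / (1 + s)"
  have "y (Suc k) - y k = ?\<alpha> *\<^sub>R (y k - x k) - ((1 + ?\<alpha>) * \<gamma>) *\<^sub>R g k"
    unfolding y_Suc x_Suc by (simp add: algebra_simps)
  then have "norm (y (Suc k) - y k) \<le> ?\<alpha> * norm (y k - x k) + (1 + ?\<alpha>) * \<gamma> * norm (g k)"
    using norm_triangle_ineq4[of "?\<alpha> *\<^sub>R (y k - x k)" "((1 + ?\<alpha>) * \<gamma>) *\<^sub>R g k"] params s_less_1
    by simp
  also have "1 + ?\<alpha> = 2 / (1 + s)" using params by (simp add: field_simps)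
  finally have "(norm (y (Suc k) - y k))\<^sup>2 \<le> (?\<alpha> * norm (y k - x k) + 2 / (1 + s) * \<gamma> * norm (g k))\<^sup>2"
    by (intro power_mono) auto
  also have "\<dots> \<le> 2 * ?\<alpha>\<^sup>2 * (norm (y k - x k))\<^sup>2 + 8 / (1 + s)\<^sup>2 * \<gamma>\<^sup>2 * (norm (g k))\<^sup>2"
    using sum_squares_bound[of "?\<alpha> * norm (y k - x k)" "2 / (1 + s) * \<gamma> * norm (g k)"]
    by (simp add: power2_sum power_mult_distrib power_divide)
  \<comment> \<open>Both coefficients are enlarged to those of
    \<open>16 * (\<gamma> / s) * S k\<close>.\<close>
  also have "\<dots> \<le> 8 * (1 - s\<^sup>2) * (norm (y k - x k))\<^sup>2 + 2 / s * \<gamma>\<^sup>2 * (norm (g k))\<^sup>2"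
  proof (intro add_mono mult_right_mono)
    have "?\<alpha> \<le> 1 - s" using params s_less_1 by (simp add: field_simps)
    moreover have "0 \<le> ?\<alpha>" using params s_less_1 by simp
    ultimately have "?\<alpha>\<^sup>2 \<le> (1 - s)\<^sup>2" by (intro power_mono)
    also have "\<dots> \<le> (1 - s) * (1 + s)"
      unfolding power2_eq_square using params s_less_1 by (intro mult_left_mono) auto
    finally have "?\<alpha>\<^sup>2 \<le> 1 - s\<^sup>2" by (simp add: algebra_simps power2_eq_square)
    moreover have "0 \<le> 1 - s\<^sup>2" using params by simp
    ultimately show "2 * ?\<alpha>\<^sup>2 \<le> 8 * (1 - s\<^sup>2)" by simp
    have "4 * s \<le> (1 + s)\<^sup>2"
      using zero_le_power2[of "1 - s"] by (simp add: power2_eq_square algebra_simps)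
    then show "8 / (1 + s)\<^sup>2 \<le> 2 / s" using params by (simp add: field_simps)
  qed auto
  also have "\<dots> = 16 * (\<gamma> / s) * S k"
  proof -
    have "\<mu> = s\<^sup>2 / \<gamma>" using params by simp
    then show ?thesis unfolding S_def using params(3,5)
      by (simp only:) (simp add: field_simps power2_eq_square)
  qed
  finally show ?thesis .
qed

text \<open>Points within \<open>r\<close> of \<open>xs\<close> are at most \<open>2 * r\<close>
  apart. This a priori bound serves to linearize the squared error in \<open>V_step\<close>.\<close>

lemma error_le_radius:
  assumes "\<And>j. j \<in> {k - K..k} \<Longrightarrow> V j \<le> \<mu> / 2 * r\<^sup>2" "0 \<le> r"
  shows "norm (g k - G (y k)) \<le> 2 * M * r\<^sup>2"
proof -
  have "norm (y k - y j) \<le> 2 * r" if "j \<in> {k - K..k}" for j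
    using norm_triangle_ineq4[of "y k - xs" "y j - xs"]
      norm_bounds(1)[OF assms(1)[OF that] assms(2)] norm_bounds(1)[OF assms(1) assms(2), of k]
    by simp
  from delayed_error[OF this] show ?thesis by (simp add: power_mult_distrib)
qed

text \<open>The displacement is at most the path length over the window, whose square is at most
  \<open>K\<close> times the sum of squared steps. As the error is quadratic in the displacement, it
  is linear in the slack.\<close>

lemma error_le_slack:
  "norm (g k - G (y k)) \<le> 8 * M * real K * (\<gamma> / s) * (\<Sum>j = k - K..<k. S j)"
proof -
  define b where "b = (\<Sum>j = k - K..<k. norm (y (Suc j) - y j))"
  have "norm (y k - y j) \<le> b" if "j \<in> {k - K..k}" for j
  proof -
    have "y k - y j = (\<Sum>i = j..<k. y (Suc i) - y i)"
      using that by (simp add: sum_Suc_diff')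
    also have "norm \<dots> \<le> (\<Sum>i = j..<k. norm (y (Suc i) - y i))" by (rule norm_sum)
    also have "\<dots> \<le> b" unfolding b_def using that by (intro sum_mono2) auto
    finally show ?thesis .
  qed
  from delayed_error[OF this] have "norm (g k - G (y k)) \<le> M / 2 * b\<^sup>2" by blast
  also have "M / 2 * b\<^sup>2 \<le> M / 2 * (real K * (16 * (\<gamma> / s) * (\<Sum>j = k - K..<k. S j)))"
  proof (intro mult_left_mono)
  have "b\<^sup>2 \<le> real K * (\<Sum>j = k - K..<k. (norm (y (Suc j) - y j))\<^sup>2)"
    unfolding b_def
    by (rule order_trans[OF power2_sum_le_card_mult_sum]) (auto intro!: mult_right_mono sum_nonneg)
  also have "\<dots> \<le> real K * (16 * (\<gamma> / s) * (\<Sum>j = k - K..<k. S j))"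
    unfolding sum_distrib_left by (intro mult_left_mono sum_mono step_length) auto
  finally show "b\<^sup>2 \<le> real K * (16 * (\<gamma> / s) * (\<Sum>j = k - K..<k. S j))" .
  qed (use params in simp)
  also have "\<dots> = 8 * M * real K * (\<gamma> / s) * (\<Sum>j = k - K..<k. S j)" by simp
  finally show ?thesis .
qed

lemma V_step:
  assumes r: "\<And>j. j \<in> {k - K..k} \<Longrightarrow> V j \<le> \<mu> / 2 * r\<^sup>2" "0 \<le> r"
    and small: "18 * (real K)\<^sup>2 * M * r * \<gamma> \<le> s"
  shows "V (Suc k) + S k \<le> (1 - s) * V k + 24 * \<gamma> * r * M * real K * (\<Sum>j = k - K..<k. S j)"
proof -
  \<comment> \<open>The error enters with total factor \<open>5 / 2 + 2 / 9 = 49 / 18\<close> times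
    \<open>s * r\<close>, rounded up to 3; times 8 from \<open>error_le_slack\<close> this gives
    24.\<close>
  let ?e = "norm (g k - G (y k))"
  have Vk: "V k \<le> \<mu> / 2 * r\<^sup>2" using r by simp
  have square: "2 * \<gamma> * ?e\<^sup>2 \<le> (2 / 9 * s * r) * ?e"
  proof (cases "K = 0")
    case True
    then show ?thesis using error_le_slack[of k] by simp
  next
    case False
    then have "(1::real) \<le> (real K)\<^sup>2" by simp
    then have "1 * (18 * M * r * \<gamma>) \<le> (real K)\<^sup>2 * (18 * M * r * \<gamma>)"
      using params r by (intro mult_right_mono) auto
    then have "18 * M * r * \<gamma> \<le> s" using small by (simp add: mult_ac)
    then have "(2 / 9 * r) * (18 * M * r * \<gamma>) \<le> (2 / 9 * r) * s"
      using r by (intro mult_left_mono) auto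
    moreover have "2 * \<gamma> * ?e \<le> 2 * \<gamma> * (2 * M * r\<^sup>2)"
      using error_le_radius[OF r] params by (intro mult_left_mono) auto
    ultimately have "2 * \<gamma> * ?e \<le> 2 / 9 * s * r" by (simp add: power2_eq_square mult_ac)
    from mult_right_mono[OF this, of ?e] show ?thesis by (simp add: power2_eq_square mult_ac)
  qed
  have "s * norm (y k - xs) + (1 - s) * norm (y k - x k) \<le> s * r + 1 * (3 / 2 * s * r)"
    using norm_bounds[OF Vk r(2)] params s_less_1 by (intro add_mono mult_mono) auto
  also have "\<dots> = 5 / 2 * s * r" by simp
  finally have linear: "?e * (s * norm (y k - xs) + (1 - s) * norm (y k - x k)) \<le> ?e * (5 / 2 * s * r)"
    by (intro mult_left_mono) auto
  have "V (Suc k) + S k \<le> (1 - s) * V k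
      + ?e * (s * norm (y k - xs) + (1 - s) * norm (y k - x k)) + 2 * \<gamma> * ?e\<^sup>2"
    unfolding V_def z_Suc S_def x_Suc unfolding z_def
  proof (rule accelerated_step[where L = L])
    show "F (y k - \<gamma> *\<^sub>R g k) \<le> F (y k) + G (y k) \<bullet> - (\<gamma> *\<^sub>R g k) + L / 2 * (norm (\<gamma> *\<^sub>R g k))\<^sup>2"
      using smooth[of "y k - \<gamma> *\<^sub>R g k" "y k"] by simp
  qed (use params s_less_1 in \<open>simp_all only: convex\<close>)
  also have "\<dots> \<le> (1 - s) * V k + 49 / 18 * (s * r * ?e)"
    using square linear by (simp add: algebra_simps)
  also have "49 / 18 * (s * r * ?e) \<le> 3 * (s * r * ?e)"
    using params r by (intro mult_right_mono) auto
  also have "3 * (s * r * ?e) \<le> 3 * (s * r * (8 * M * real K * (\<gamma> / s) * (\<Sum>j = k - K..<k. S j)))"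
    using params r error_le_slack[of k] by (intro mult_left_mono) auto
  also have "\<dots> = 24 * \<gamma> * r * M * real K * (\<Sum>j = k - K..<k. S j)"
    using params by (simp add: field_simps)
  finally show ?thesis by simp
qed

section \<open>Decay of the energy from an initial radius\<close>

context
  fixes r
  assumes V_0: "V 0 \<le> \<mu> / 2 * r\<^sup>2" and r: "0 \<le> r"
    and small: "18 * (real K)\<^sup>2 * M * r * \<gamma> \<le> s"
begin

text \<open>Strong induction: the bound at earlier indices keeps the energy below
  \<open>V 0\<close>, so \<open>V_step\<close> applies with the fixed radius \<open>r\<close>.
  Descent starts at 0, where no earlier slack is owed, and \<open>s * V k\<close> is the gain being
  summed.\<close>

lemma V_sum_le: "V N + s * (\<Sum>k<N. V k) \<le> V 0"
proof (induction N rule: less_induct)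
  case (less N)
  have "V N + (\<Sum>k = 0..<N. s * V k) \<le> V 0 + (\<Sum>j<0. S j)"
  proof (rule delayed_descent[where \<epsilon> = "24 * \<gamma> * r * M * real K" and K = K])
    have "24 * \<gamma> * r * M * real K * real K = 24 / 18 * (18 * (real K)\<^sup>2 * M * r * \<gamma>)"
      by (simp add: power2_eq_square)
    also have "\<dots> \<le> 24 / 18 * s" by (intro mult_left_mono small) auto
    also have "\<dots> \<le> 1" using s_le by simp
    finally show "24 * \<gamma> * r * M * real K * real K \<le> 1" .
    fix k assume k: "k < N"
    have "V j \<le> \<mu> / 2 * r\<^sup>2" if "j \<in> {k - K..k}" for j
    proof -
      have "0 \<le> s * (\<Sum>k<j. V k)"
        using params V_nonneg by (intro mult_nonneg_nonneg sum_nonneg) auto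
      then show ?thesis using less.IH[of j] that k V_0 by simp
    qed
    from V_step[OF this r small]
    show "V (Suc k) + S k + s * V k \<le> V k + 24 * \<gamma> * r * M * real K * (\<Sum>j = k - K..<k. S j)"
      by (simp add: algebra_simps)
  qed (use params r S_nonneg in auto)
  then show ?case by (simp add: sum_distrib_left lessThan_atLeast0)
qed

text \<open>The term \<open>k = 0\<close> of the summed gain already yields a fixed factor below 1
  relative to \<open>V 0\<close>, uniformly in \<open>k\<close>.\<close>

lemma V_Suc_le: "V (Suc k) \<le> (1 - s) * V 0"
proof -
  have "V 0 \<le> (\<Sum>k<Suc k. V k)"
    by (rule member_le_sum) (auto simp: V_nonneg)
  then have "s * V 0 \<le> s * (\<Sum>k<Suc k. V k)" using params by simp
  then show ?thesis using V_sum_le[of "Suc k"] by (simp add: algebra_simps)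
qed

lemma V_tendsto_0: "V \<longlonglongrightarrow> 0"
proof -
  have "(\<Sum>k<N. V k) \<le> V 0 / s" for N
    using V_sum_le[of N] V_nonneg[of N] params by (simp add: field_simps)
  then have "summable V" using V_nonneg by (intro summableI_nonneg_bounded) auto
  then show ?thesis by (rule summable_LIMSEQ_zero)
qed

text \<open>Since the energy tends to 0, it eventually lies within any radius \<open>q\<close>; a
  small \<open>q\<close> makes the perturbation weak enough for the rate \<open>1 - s\<close>
  itself.\<close>

lemma V_geometric: "\<exists>C. \<forall>k. V k \<le> C * (1 - s) ^ k"
proof -
  \<comment> \<open>\<open>A\<close> dominates both ratios that bound \<open>1 / q\<close>: one for
    the smallness condition of \<open>V_step\<close>, one for the weight allowed by
    \<open>geometric_bound_of_delayed_descent\<close>.\<close>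
  define A where "A = 1 + 18 * (real K)\<^sup>2 * M * \<gamma> / s + 24 * \<gamma> * M * (real K)\<^sup>2 / (1 - s) ^ K"
  define q where "q = 1 / A"
  have A: "1 \<le> A" "18 * (real K)\<^sup>2 * M * \<gamma> / s \<le> A" "24 * \<gamma> * M * (real K)\<^sup>2 / (1 - s) ^ K \<le> A"
    using params s_less_1 by (auto simp: A_def)
  then have q: "0 < q" by (simp add: q_def)
  have q1: "18 * (real K)\<^sup>2 * M * q * \<gamma> \<le> s"
    using A params by (simp add: q_def field_simps)
  have q2: "24 * \<gamma> * q * M * real K * real K \<le> (1 - s) ^ K"
    using A params s_less_1 by (simp add: q_def field_simps power2_eq_square)
  have "0 < \<mu> / 2 * q\<^sup>2" using q params by simp
  from order_tendstoD(2)[OF V_tendsto_0 this]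
  obtain n where n: "\<And>k. n \<le> k \<Longrightarrow> V k < \<mu> / 2 * q\<^sup>2" by (auto simp: eventually_sequentially)
  \<comment> \<open>Starting at \<open>n + K\<close> keeps the whole delay window at or beyond
    \<open>n\<close>.\<close>
  have "\<exists>C. \<forall>k\<ge>n + K. V k \<le> C * (1 - s) ^ k"
  proof (rule geometric_bound_of_delayed_descent[OF S_nonneg _ _ _ q2])
    fix k assume k: "n + K \<le> k"
    have "V j \<le> \<mu> / 2 * q\<^sup>2" if "j \<in> {k - K..k}" for j
      by (rule less_imp_le[OF n]) (use that k in auto)
    from V_step[OF this _ q1] q
    show "V (Suc k) + S k \<le> (1 - s) * V k + 24 * \<gamma> * q * M * real K * (\<Sum>j = k - K..<k. S j)"
      by simp
  qed (use params s_less_1 q in auto)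
  then obtain C where C: "\<And>k. n + K \<le> k \<Longrightarrow> V k \<le> C * (1 - s) ^ k" by blast
  \<comment> \<open>The finite sum covers the indices below \<open>n + K\<close>.\<close>
  define C' where "C' = max C (\<Sum>k<n + K. V k / (1 - s) ^ k)"
  have "V k \<le> C' * (1 - s) ^ k" for k
  proof (cases "n + K \<le> k")
    case True
    then have "V k \<le> C * (1 - s) ^ k" by (rule C)
    also have "\<dots> \<le> C' * (1 - s) ^ k" 
      using s_less_1 by (intro mult_right_mono) (auto simp: C'_def)
    finally show ?thesis .
  next
    case False
    then have "V k / (1 - s) ^ k \<le> (\<Sum>k<n + K. V k / (1 - s) ^ k)"
      using s_less_1 by (intro member_le_sum) (auto simp: V_nonneg)
    also have "\<dots> \<le> C'" by (simp add: C'_def)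
    finally show ?thesis using s_less_1 by (simp add: field_simps)
  qed
  then show ?thesis by blast
qed

end

end

section \<open>Convergence of A-CIAG\<close>

text \<open>The constant \<open>C\<close> is traded for \<open>b\<close> by slowing the rate: one
  factor \<open>sqrt \<rho> ^ k\<close> absorbs \<open>C\<close> for large \<open>k\<close>, while
  the uniform factor handles the finitely many others.\<close>

lemma geometric_rate_strict:
  fixes h :: "nat \<Rightarrow> real"
  assumes \<rho>: "0 < \<rho>" "\<rho> < 1" and b: "0 \<le> b" and \<delta>\<^sub>0: "0 < \<delta>\<^sub>0" "\<delta>\<^sub>0 < 1"
    and uniform: "\<And>k. 1 \<le> k \<Longrightarrow> h k \<le> \<delta>\<^sub>0 * b"
    and geometric: "\<And>k. 1 \<le> k \<Longrightarrow> h k \<le> C * \<rho> ^ k"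
  shows "\<exists>\<delta>. 0 \<le> \<delta> \<and> \<delta> < 1 \<and> (\<forall>k\<ge>1. h k \<le> \<delta> ^ k * b)"
proof (cases "b = 0")
  case True
  then show ?thesis using uniform by (intro exI[of _ 0]) auto
next
  case False
  with b have b: "0 < b" by simp
  have "(\<lambda>k. C * sqrt \<rho> ^ k) \<longlonglongrightarrow> C * 0"
    using \<rho> by (intro tendsto_intros LIMSEQ_realpow_zero) auto
  then have "eventually (\<lambda>k. C * sqrt \<rho> ^ k < b) sequentially"
    using b by (intro order_tendstoD(2)) auto
  then obtain n where n: "\<And>k. n \<le> k \<Longrightarrow> C * sqrt \<rho> ^ k < b" by (auto simp: eventually_sequentially)
  \<comment> \<open>The root ensures \<open>\<delta>\<^sub>0 \<le> \<delta> ^ Suc n\<close>, hence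
    \<open>\<delta>\<^sub>0 \<le> \<delta> ^ k\<close> for all \<open>k < n\<close>.\<close>
  define \<delta> where "\<delta> = max (root (Suc n) \<delta>\<^sub>0) (sqrt \<rho>)"
  have \<delta>: "0 \<le> \<delta>" "\<delta> < 1"
    using \<rho> \<delta>\<^sub>0 by (auto simp: \<delta>_def real_root_lt_1_iff le_max_iff_disj)
  have "h k \<le> \<delta> ^ k * b" if k: "1 \<le> k" for k
  proof (cases "n \<le> k")
    case True
    have "h k \<le> C * sqrt \<rho> ^ k * sqrt \<rho> ^ k"
      using geometric[OF k] \<rho> by (simp add: mult.assoc power_mult_distrib[symmetric])
    also have "\<dots> \<le> b * sqrt \<rho> ^ k"
      using n[OF True] \<rho> by (intro mult_right_mono) auto
    also have "\<dots> \<le> b * \<delta> ^ k"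
      using b \<rho> by (intro mult_left_mono power_mono) (auto simp: \<delta>_def)
    finally show ?thesis by (simp add: mult.commute)
  next
    case False
    have "\<delta>\<^sub>0 = root (Suc n) \<delta>\<^sub>0 ^ Suc n" using \<delta>\<^sub>0 by (simp del: power_Suc)
    also have "\<dots> \<le> \<delta> ^ Suc n"
      using \<delta>\<^sub>0 by (intro power_mono) (auto simp: \<delta>_def)
    also have "\<dots> \<le> \<delta> ^ k" using \<delta> False by (intro power_decreasing) auto
    finally have "\<delta>\<^sub>0 * b \<le> \<delta> ^ k * b" using b by simp
    then show ?thesis using uniform[OF k] by simp
  qed
  then show ?thesis using \<delta> by blast
qed

lemma last_access_bounds:
  assumes "1 \<le> k"
  shows "1 \<le> last_access idx i k" "last_access idx i k \<le> k"
  using assms by (auto simp: last_access_def intro!: Max_ge)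

text \<open>Each summand is a first-order Taylor expansion of a component gradient around its
  delayed point, so the remainders add up.\<close>

lemma curvature_aided_gradient_error:
  fixes f :: "nat \<Rightarrow> real ^ 'd \<Rightarrow> real"
  assumes C2: "\<And>i. i \<in> {1..m} \<Longrightarrow> twice_continuously_differentiable (f i)"
    and lipschitz: "\<And>i. i \<in> {1..m} \<Longrightarrow> hessian_lipschitz (M i) (f i)"
    and near: "\<And>i. i \<in> {1..m} \<Longrightarrow> norm (v k - v (last_access idx i k)) \<le> b"
  shows "norm (curvature_aided_gradient m f idx v k - gradient (\<lambda>x. \<Sum>i = 1..m. f i x) (v k))
    \<le> (\<Sum>i = 1..m. M i) / 2 * b\<^sup>2"
proof -
  let ?w = "\<lambda>i. v (last_access idx i k)"
  have "gradient (\<lambda>x. \<Sum>i = 1..m. f i x) (v k) = (\<Sum>i = 1..m. gradient (f i) (v k))"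
    using C2 by (intro gradient_sum) (auto simp: twice_continuously_differentiable_def differentiable_on_def)
  then have "curvature_aided_gradient m f idx v k - gradient (\<lambda>x. \<Sum>i = 1..m. f i x) (v k)
      = (\<Sum>i = 1..m. gradient (f i) (?w i) + hessian (f i) (?w i) *v (v k - ?w i) - gradient (f i) (v k))"
    by (simp add: curvature_aided_gradient_def Let_def sum_subtractf)
  also have "norm \<dots> \<le> (\<Sum>i = 1..m. M i / 2 * b\<^sup>2)"
  proof (rule sum_norm_le)
    fix i assume i: "i \<in> {1..m}"
    have "norm (gradient (f i) (?w i) + hessian (f i) (?w i) *v (v k - ?w i) - gradient (f i) (v k))
        \<le> M i / 2 * (norm (v k - ?w i))\<^sup>2"
      using C2[OF i] lipschitz[OF i] by (rule gradient_taylor_remainder)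
    also have "\<dots> \<le> M i / 2 * b\<^sup>2"
      using near[OF i] hessian_lipschitz_nonneg[OF lipschitz[OF i]]
      by (intro mult_left_mono power_mono) auto
    finally show "norm (gradient (f i) (?w i) + hessian (f i) (?w i) *v (v k - ?w i) - gradient (f i) (v k))
        \<le> M i / 2 * b\<^sup>2" .
  qed
  finally show ?thesis by (simp add: sum_divide_distrib sum_distrib_right)
qed

theorem theorem2:
  fixes m K :: nat
    and f :: "nat \<Rightarrow> real ^ 'd \<Rightarrow> real" and F :: "real ^ 'd \<Rightarrow> real"
    and idx :: "nat \<Rightarrow> nat"
    and \<mu> L LH c \<gamma> \<alpha> :: real and LHi :: "nat \<Rightarrow> real"
    and \<theta> :: "nat \<Rightarrow> real ^ 'd" and \<theta>s :: "real ^ 'd"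
    and h :: "nat \<Rightarrow> real"
  assumes C2: "\<And>i. i \<in> {1..m} \<Longrightarrow> twice_continuously_differentiable (f i)"
    and F: "F = (\<lambda>x. \<Sum>i = 1..m. f i x)"
    and delay: "\<And>i k. i \<in> {1..m} \<Longrightarrow> k \<ge> 1 \<Longrightarrow>
          0 \<le> int k - int (last_access idx i k) \<and> int k - int (last_access idx i k) \<le> int K"
    and mu_L: "0 < \<mu>" "\<mu> \<le> L"
    and convex: "strongly_convex \<mu> F"
    and smooth: "L_smooth L F"
    and lipschitz: "\<And>i. i \<in> {1..m} \<Longrightarrow> hessian_lipschitz (LHi i) (f i)"
    and LH: "LH = (\<Sum>i = 1..m. LHi i)"
    and c_pos: "c > 0"
    and \<gamma>: "\<gamma> = c / L"
    and \<alpha>: "\<alpha> = (1 - sqrt (\<mu> * \<gamma>)) / (1 + sqrt (\<mu> * \<gamma>))"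
    and iterates: "A_CIAG m f idx \<gamma> \<alpha> \<theta>"
    and minimizer: "\<And>x. F \<theta>s \<le> F x"
    and h: "h = (\<lambda>k. F (\<theta> k) - F \<theta>s)"
    and c_less: "ereal c < Min {cbar1 \<mu> L LH K (h 1), cbar2 \<mu> L LH K (h 1),
                                ereal (cbar3 \<mu> L LH K (h 1)), ereal (1 / 2)}"
  shows "(\<exists>\<delta>. 0 \<le> \<delta> \<and> \<delta> < 1 \<and>
            (\<forall>k\<ge>1. h k \<le> \<delta> ^ nat \<lceil>real k / (2 * real K + 1)\<rceil> * (2 * h 1)))
       \<and> (\<exists>hbar :: nat \<Rightarrow> real.
            (\<forall>k\<ge>1. h k \<le> hbar k) \<and> hbar 1 = h 1 \<and>
            (\<lambda>k. hbar (k + 1) / hbar k) \<longlonglongrightarrow> 1 - sqrt (\<mu> * \<gamma>) \<and>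
            1 - sqrt (\<mu> * \<gamma>) = 1 - sqrt (c / (L / \<mu>)))"
proof -
  define s where "s = sqrt (\<mu> * \<gamma>)"
  have L: "0 < L" using mu_L by simp
  have LHi: "0 \<le> LHi i" if "i \<in> {1..m}" for i
    using hessian_lipschitz_nonneg[OF lipschitz[OF that]] .
  have LH0: "0 \<le> LH" unfolding LH by (intro sum_nonneg LHi)
  have \<gamma>0: "0 < \<gamma>" using c_pos L by (simp add: \<gamma>)
  have h_nonneg: "0 \<le> h k" for k using minimizer by (simp add: h)
  have c: "c < 1 / 2" "c < cbar3 \<mu> L LH K (h 1)" using c_less by simp_all
  have s: "0 < s" "s\<^sup>2 = \<mu> * \<gamma>" using mu_L \<gamma>0 by (simp_all add: s_def)
  have "s\<^sup>2 \<le> c" using mu_L L c_pos by (simp add: s \<gamma> field_simps)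
  then have s_half: "s\<^sup>2 \<le> 1 / 2" using c by simp
  \<comment> \<open>Chosen so that \<open>\<mu> / 2 * r\<^sup>2\<close> equals
    \<open>2 * h 1\<close>, the bound on the initial energy.\<close>
  define r where "r = 2 * sqrt (h 1 / \<mu>)"
  have r: "0 \<le> r" "\<mu> / 2 * r\<^sup>2 = 2 * h 1"
    using h_nonneg[of 1] mu_L by (auto simp: r_def power_mult_distrib)
  \<comment> \<open>The square of the left side is \<open>s\<^sup>2 * (\<gamma> * B)\<close>, where
    \<open>B\<close> is the middle summand in the denominator of \<open>cbar3\<close>; thus
    \<open>c < cbar3\<close> gives \<open>\<gamma> * B \<le> 1\<close>.\<close>
  have small: "18 * (real K)\<^sup>2 * LH * r * \<gamma> \<le> s"
  proof -
    define A where "A = sqrt 324 * real K ^ 2 * LH * (h 1 powr (1 / 2) / sqrt \<mu>)"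
    define B where "B = 1296 * real K ^ 4 * LH ^ 2 * (h 1 / \<mu> ^ 2)"
    have AB: "0 \<le> A" "0 \<le> B"
      using LH0 h_nonneg[of 1] mu_L by (simp_all add: A_def B_def)
    have "c < L / (A + B + \<mu>)" using c(2) by (simp add: cbar3_def A_def B_def)
    then have "c * (A + B + \<mu>) < L" using AB mu_L by (simp add: pos_less_divide_eq)
    moreover have "c * B \<le> c * (A + B + \<mu>)" using AB mu_L c_pos by (intro mult_left_mono) auto
    ultimately have "\<gamma> * B \<le> 1" using L by (simp add: \<gamma>)
    then have "s\<^sup>2 * (\<gamma> * B) \<le> s\<^sup>2" by (simp add: mult_left_le)
    moreover have "(18 * (real K)\<^sup>2 * LH * r * \<gamma>)\<^sup>2 = s\<^sup>2 * (\<gamma> * B)"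
    proof -
      have r2: "r\<^sup>2 = 4 * (h 1 / \<mu>)"
        using h_nonneg[of 1] mu_L by (simp add: r_def power_mult_distrib)
      have "(18 * (real K)\<^sup>2 * LH * r * \<gamma>)\<^sup>2 = 324 * real K ^ 4 * LH\<^sup>2 * r\<^sup>2 * \<gamma>\<^sup>2"
        by (simp add: power_mult_distrib flip: power_mult)
      also have "\<dots> = \<mu> * \<gamma> * (\<gamma> * B)"
        unfolding r2 B_def using mu_L by (simp add: power2_eq_square)
      finally show ?thesis by (simp only: s(2))
    qed
    ultimately have "(18 * (real K)\<^sup>2 * LH * r * \<gamma>)\<^sup>2 \<le> s\<^sup>2" by (simp only:)
    then show ?thesis by (rule power2_le_imp_le) (use s in simp)
  qed
  define x y g where "x = (\<lambda>n. \<theta> (Suc n))" and "y = (\<lambda>n. extrapolated \<alpha> \<theta> (Suc n))"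
    and "g = (\<lambda>n. curvature_aided_gradient m f idx (extrapolated \<alpha> \<theta>) (Suc n))"
  interpret perturbed_acceleration F "gradient F" x y g \<theta>s \<mu> L \<gamma> s LH K
  proof
    show "F v \<le> F u + gradient F u \<bullet> (v - u) + L / 2 * (norm (v - u))\<^sup>2" for u v
      using smooth by (simp add: L_smooth_def)
    show "F v \<ge> F u + gradient F u \<bullet> (v - u) + \<mu> / 2 * (norm (v - u))\<^sup>2" for u v
      using convex by (simp add: strongly_convex_def)
    show "x (Suc k) = y k - \<gamma> *\<^sub>R g k" for k
      using iterates by (simp add: A_CIAG_def x_def y_def g_def)
    show "y (Suc k) = x (Suc k) + ((1 - s) / (1 + s)) *\<^sub>R (x (Suc k) - x k)" for k
      by (simp add: x_def y_def extrapolated_def s_def \<alpha>)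
    show "norm (g k - gradient F (y k)) \<le> LH / 2 * b\<^sup>2"
      if near: "\<And>j. j \<in> {k - K..k} \<Longrightarrow> norm (y k - y j) \<le> b" for k b
      unfolding F LH g_def y_def
    proof (rule curvature_aided_gradient_error[OF C2 lipschitz])
      fix i assume i: "i \<in> {1..m}"
      \<comment> \<open>\<open>last_access\<close> is at least 1, so the subtraction is exact and
        undoes the index shift of \<open>y\<close>.\<close>
      define j where "j = last_access idx i (Suc k) - 1"
      have "last_access idx i (Suc k) = Suc j" "j \<in> {k - K..k}"
        using delay[OF i, of "Suc k"] last_access_bounds[of "Suc k" idx i] by (auto simp: j_def)
      with near[of j]
      show "norm (extrapolated \<alpha> \<theta> (Suc k) - extrapolated \<alpha> \<theta> (last_access idx i (Suc k))) \<le> b"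
        by (simp add: y_def)
    qed
    show "L * \<gamma> \<le> 1 / 2" using c L by (simp add: \<gamma>)
  qed (use mu_L L \<gamma>0 s s_half LH0 minimizer in \<open>simp_all add: x_def y_def extrapolated_def\<close>)
  have V_0: "V 0 \<le> 2 * h 1" using V_0_le by (simp add: h x_def)
  then have V_0_r: "V 0 \<le> \<mu> / 2 * r\<^sup>2" by (simp only: r)
  have h_V: "h k \<le> V (k - 1)" if "1 \<le> k" for k
    using gap_le_V[of "k - 1"] that by (simp add: h x_def)
  obtain C where C: "\<And>k. V k \<le> C * (1 - s) ^ k" using V_geometric[OF V_0_r r(1) small] by blast
  have geometric: "h k \<le> C / (1 - s) * (1 - s) ^ k" if "1 \<le> k" for k
  proof -
    have "(1 - s) ^ k = (1 - s) * (1 - s) ^ (k - 1)" using that by (simp add: power_eq_if)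
    then show ?thesis using h_V[OF that] C[of "k - 1"] s_less_1 by simp
  qed
  \<comment> \<open>The 1/2 is for \<open>k = 1\<close>, where \<open>h 1\<close> is half of
    \<open>2 * h 1\<close>; later indices use \<open>V_Suc_le\<close>.\<close>
  have uniform: "h k \<le> max (1 / 2) (1 - s) * (2 * h 1)" if k: "1 \<le> k" for k
  proof (cases "k = 1")
    case True
    then show ?thesis using mult_right_mono[of "1 / 2" "max (1 / 2) (1 - s)" "2 * h 1"] h_nonneg[of 1] by simp
  next
    case False
    with k have "k = Suc (Suc (k - 2))" by simp
    then obtain n where n: "k = Suc (Suc n)" ..
    have "h k \<le> (1 - s) * V 0"
      using h_V[OF k] V_Suc_le[OF V_0_r r(1) small, of n] by (simp add: n)
    also have "\<dots> \<le> max (1 / 2) (1 - s) * (2 * h 1)"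
      using V_0 s_less_1 V_nonneg by (intro mult_mono) auto
    finally show ?thesis .
  qed
  have "\<exists>\<delta>. 0 \<le> \<delta> \<and> \<delta> < 1 \<and> (\<forall>k\<ge>1. h k \<le> \<delta> ^ k * (2 * h 1))"
  proof (rule geometric_rate_strict[OF _ _ _ _ _ uniform geometric])
    show "0 < max (1 / 2) (1 - s)" by (simp add: less_max_iff_disj)
  qed (use s s_less_1 h_nonneg[of 1] in simp_all)
  then obtain \<delta> where \<delta>: "0 \<le> \<delta>" "\<delta> < 1" "\<And>k. 1 \<le> k \<Longrightarrow> h k \<le> \<delta> ^ k * (2 * h 1)" by blast
  \<comment> \<open>A per-iteration rate suffices, as the stated exponent is at most
    \<open>k\<close> and \<open>\<delta> < 1\<close>.\<close>
  have delayed_rate: "h k \<le> \<delta> ^ nat \<lceil>real k / (2 * real K + 1)\<rceil> * (2 * h 1)" if "1 \<le> k" for k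
  proof -
    have "real k / (2 * real K + 1) \<le> real k" by (simp add: field_simps)
    then have "nat \<lceil>real k / (2 * real K + 1)\<rceil> \<le> k" by (simp add: nat_le_iff ceiling_le_iff)
    then have "\<delta> ^ k \<le> \<delta> ^ nat \<lceil>real k / (2 * real K + 1)\<rceil>"
      using \<delta> by (intro power_decreasing) auto
    then have "\<delta> ^ k * (2 * h 1) \<le> \<delta> ^ nat \<lceil>real k / (2 * real K + 1)\<rceil> * (2 * h 1)"
      using h_nonneg[of 1] by (intro mult_right_mono) auto
    then show ?thesis using \<delta>(3)[OF that] by simp
  qed
  \<comment> \<open>The maximum with 1 keeps \<open>hbar k\<close> positive for
    \<open>k \<ge> 2\<close>, even if \<open>C\<close> is not. From there on \<open>hbar\<close> is
    exactly geometric, so the quotient is constant.\<close>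
  define D where "D = max 1 (C / (1 - s))"
  define hbar where "hbar k = (if k = 1 then h 1 else D * (1 - s) ^ k)" for k
  have hbar_ge: "h k \<le> hbar k" if "1 \<le> k" for k
  proof -
    have "C / (1 - s) * (1 - s) ^ k \<le> D * (1 - s) ^ k"
      using s_less_1 by (intro mult_right_mono) (auto simp: D_def)
    then show ?thesis using geometric[OF that] by (simp add: hbar_def)
  qed
  have ratio: "(\<lambda>k. hbar (k + 1) / hbar k) \<longlonglongrightarrow> 1 - s"
  proof (rule tendsto_eventually)
    have "D > 0" by (simp add: D_def)
    then show "eventually (\<lambda>k. hbar (k + 1) / hbar k = 1 - s) sequentially"
      using s_less_1 by (intro eventually_sequentiallyI[of 2]) (simp add: hbar_def)
  qed
  have hbar_1: "hbar 1 = h 1" by (simp add: hbar_def)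
  have condition: "\<mu> * \<gamma> = c / (L / \<mu>)" by (simp add: \<gamma>)
  show ?thesis
  proof (intro conjI exI[of _ \<delta>] exI[of _ hbar] allI impI)
    show "(\<lambda>k. hbar (k + 1) / hbar k) \<longlonglongrightarrow> 1 - sqrt (\<mu> * \<gamma>)"
      using ratio by (simp only: s_def)
    show "1 - sqrt (\<mu> * \<gamma>) = 1 - sqrt (c / (L / \<mu>))" by (simp only: condition)
  qed (fact \<delta>(1) \<delta>(2) hbar_1 | rule delayed_rate hbar_ge, assumption)+
qed

end
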